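(* Let $F_0,k,b,z_0>0$, $T=\frac{4\pi}{b}$, and $f(z)=\exp\left(-2\frac{z^2}{z_0^2}\right)$. Then the boundary-value problem $$z'(t)=F_z(t,z(t)),\ t\in[0,T],\qquad z(0)-z(T)=0,$$ possesses at least one solution, which can be extended to a periodic solution (with period $T$) of the equation $z'=F_z(t,z)$.
   Context: Here $V(t,z)=F_0 f(z)\left(\cos\left(kz-\frac{bt}{2}\right)\right)^2$ and $F_z(t,z)=\frac{\partial V}{\partial z}(t,z)$, i.e. $$F_z(t,z)=-kF_0 f(z)\sin(2kz-bt)+F_0\left(\cos\left(kz-\frac{bt}{2}\right)\right)^2 f'(z).$$ A periodic solution with period $T$ is a solution $z:\mathbb{R}\to\mathbb{R}$ of $z'(t)=F_z(t,z(t))$ with $z(t+T)=z(t)$ for all $t$. *)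

theory Defs
  imports "HOL-Analysis.Analysis"
begin

definition V :: "real \<Rightarrow> real \<Rightarrow> real \<Rightarrow> (real \<Rightarrow> real) \<Rightarrow> real \<Rightarrow> real \<Rightarrow> real" where
  "V F0 k b f t z = F0 * f z * (cos (k * z - b * t / 2))\<^sup>2"

definition Fz :: "real \<Rightarrow> real \<Rightarrow> real \<Rightarrow> (real \<Rightarrow> real) \<Rightarrow> real \<Rightarrow> real \<Rightarrow> real" where
  "Fz F0 k b f t z = deriv (\<lambda>y. V F0 k b f t y) z"

lemma V_has_derivative:
  assumes "(f has_real_derivative f') (at z)"
  shows "((\<lambda>y. V F0 k b f t y) has_real_derivative
      - k * F0 * f z * sin (2 * k * z - b * t) + F0 * (cos (k * z - b * t / 2))\<^sup>2 * f') (at z)"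
proof -
  have "sin (2 * k * z - b * t) = 2 * sin (k * z - b * t / 2) * cos (k * z - b * t / 2)"
    using sin_double[of "k * z - b * t / 2"] by (simp add: algebra_simps)
  then show ?thesis
    unfolding V_def
    by (auto intro!: derivative_eq_intros assms simp: algebra_simps power2_eq_square)
qed

lemma Fz_eq:
  assumes "f differentiable at z"
  shows "Fz F0 k b f t z =
    - k * F0 * f z * sin (2 * k * z - b * t) + F0 * (cos (k * z - b * t / 2))\<^sup>2 * deriv f z"
proof -
  have "(f has_real_derivative deriv f z) (at z)"
    using assms by (simp add: DERIV_deriv_iff_real_differentiable)
  then show ?thesis
    unfolding Fz_def by (intro DERIV_imp_deriv V_has_derivative)
qed

text \<open>At the two end points of the interval the derivative is one-sided.\<close>

definition periodic_bvp_solution ::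
    "(real \<Rightarrow> real \<Rightarrow> real) \<Rightarrow> real \<Rightarrow> (real \<Rightarrow> real) \<Rightarrow> bool" where
  "periodic_bvp_solution G T z \<longleftrightarrow>
    (\<forall>t\<in>{0..T}. (z has_real_derivative G t (z t)) (at t within {0..T})) \<and> z 0 - z T = 0"

definition periodic_solution ::
    "(real \<Rightarrow> real \<Rightarrow> real) \<Rightarrow> real \<Rightarrow> (real \<Rightarrow> real) \<Rightarrow> bool" where
  "periodic_solution G T z \<longleftrightarrow>
    (\<forall>t. (z has_real_derivative G t (z t)) (at t)) \<and> (\<forall>t. z (t + T) = z t)"

end

theory Submission
  imports Defs
begin

text \<open>
  Write \<open>\<theta> = k z - b t / 2\<close>, so that the potential is \<open>V = F0 f(z) cos\<^sup>2 \<theta>\<close>. The force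
  \<open>F = V_z\<close> has no sign that could confine the motion: its term \<open>- k F0 f(z) sin (2 \<theta>)\<close>
  oscillates in time. However, \<open>V\<close> depends on time through \<open>\<theta>\<close> only, and
  \<open>V_t = (b / 2) F0 f(z) sin (2 \<theta>)\<close> is the oscillating term up to the factor \<open>- b / (2 k)\<close>. Along
  a solution \<open>V_t = dV/dt - F\<^sup>2\<close>, because \<open>z' = V_z\<close>. Hence the corrected position
  \<open>W = z + (2 k / b) V\<close> satisfies the exact identity
  \<open>dW/dt = F0 f'(z) cos\<^sup>2 \<theta> + (2 k / b) F\<^sup>2\<close> (lemma \<open>energy_balance\<close>).

  For the Gaussian profile with \<open>f' = - 2 a z f\<close>, both terms carry the factor \<open>f(z) cos\<^sup>2 \<theta>\<close>, and the
  second one has another factor \<open>f(z)\<close>. So \<open>W\<close> does not decrease while \<open>z \<le> 0\<close>, and does not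
  increase while \<open>z\<close> is large (lemma \<open>DERIV_W_along_solution\<close>). The force is bounded, so a
  solution that starts far out stays far out during one period; and as \<open>W\<close> is periodic in
  \<open>t\<close> and strictly increasing in \<open>z\<close> far out, the solution is after one period no farther out
  than its starting point. The period map \<open>z(0) \<mapsto> z(T)\<close> thus does not move a far left point to
  the left, nor a far right point to the right; it is continuous, and the intermediate value
  theorem gives a fixed point. The period map exists and is continuous because the force is
  globally Lipschitz in \<open>z\<close> (lemma \<open>lipschitz_flow\<close>). A solution on \<open>[0, T]\<close> with equal end
  values extends periodically since the force is \<open>T\<close>-periodic in time.
\<close>

section \<open>Flow of a Lipschitz equation on a compact interval\<close>

text \<open>
  Existence and continuous dependence come from one contraction estimate. For the unknown
  \<open>u(t) = exp (- c t) z(t)\<close> with \<open>c \<ge> 2 L\<close>, the integral operator contracts the supremum norm by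
  the factor \<open>1/2\<close> on an interval of any length. The same estimate for two initial values
  \<open>x\<close> and \<open>y\<close> bounds the distance of the two fixed points by \<open>2 \<bar>x - y\<bar>\<close>.
\<close>

lemma lipschitz_flow:
  fixes G :: "real \<Rightarrow> real \<Rightarrow> real"
  assumes T: "0 \<le> T"
    and cont: "\<And>z. continuous_on {0..T} z \<Longrightarrow> continuous_on {0..T} (\<lambda>t. G t (z t))"
    and lip: "\<And>t x y. \<bar>G t x - G t y\<bar> \<le> L * \<bar>x - y\<bar>"
  obtains \<phi> where "\<And>x. \<phi> x 0 = x"
    and "\<And>x t. t \<in> {0..T} \<Longrightarrow> (\<phi> x has_real_derivative G t (\<phi> x t)) (at t within {0..T})"
    and "continuous_on UNIV (\<lambda>x. \<phi> x T)"
proof -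
  define c where "c = 2 * max L 1"
  have c: "c > 0" and Lc: "L \<le> c / 2"
    by (auto simp: c_def)
  \<comment> \<open>Functions on \<open>[0, T]\<close> are represented by bounded continuous functions on the whole line
    through the retraction \<open>\<tau>\<close>, because these form a complete metric space as a type.\<close>
  define \<tau> where "\<tau> t = max 0 (min t T)" for t :: real
  have \<tau>: "\<tau> t \<in> {0..T}" for t
    using T by (auto simp: \<tau>_def)
  have \<tau>_id: "\<tau> t = t" if "t \<in> {0..T}" for t
    using that by (auto simp: \<tau>_def)
  have \<tau>_cont: "continuous_on UNIV \<tau>"
    unfolding \<tau>_def by (intro continuous_intros)
  define g where "g u s = G s (exp (c * s) * apply_bcontfun u s)" for u s
  have g_cont: "continuous_on {0..T} (g u)" for u
    unfolding g_def by (intro cont continuous_intros continuous_on_apply_bcontfun)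
  have g_int: "g u integrable_on {0..s}" if "s \<in> {0..T}" for u s
    by (rule integrable_continuous_real, rule continuous_on_subset[OF g_cont]) (use that in auto)
  define h where "h x u s = exp (- (c * s)) * (x + integral {0..s} (g u))" for x u s
  have h_cont: "continuous_on {0..T} (h x u)" for x u
    unfolding h_def by (intro continuous_intros indefinite_integral_continuous_1
        integrable_continuous_real g_cont)
  have h_bcont: "(\<lambda>t. h x u (\<tau> t)) \<in> bcontfun" for x u
  proof -
    have "bounded (h x u ` {0..T})"
      by (intro compact_imp_bounded compact_continuous_image h_cont) simp
    then have "bounded (range (\<lambda>t. h x u (\<tau> t)))"
      by (rule bounded_subset) (use \<tau> in auto)
    moreover have "continuous_on UNIV (\<lambda>t. h x u (\<tau> t))"
      by (rule continuous_on_compose2[OF h_cont \<tau>_cont]) (use \<tau> in auto)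
    ultimately show ?thesis
      by (simp add: bcontfun_def)
  qed
  define \<Phi> where "\<Phi> x u = Bcontfun (\<lambda>t. h x u (\<tau> t))" for x u
  have \<Phi>: "apply_bcontfun (\<Phi> x u) t = h x u (\<tau> t)" for x u t
    by (simp add: \<Phi>_def Bcontfun_inverse h_bcont)
  \<comment> \<open>The factor is \<open>1/2\<close> because \<open>exp (- c s)\<close> times the integral of \<open>L exp (c r)\<close> over \<open>[0, s]\<close>
    is at most \<open>L / c \<le> 1/2\<close> when \<open>L \<ge> 0\<close>, for every length \<open>s\<close>.\<close>
  have contr: "dist (\<Phi> x u) (\<Phi> y v) \<le> \<bar>x - y\<bar> + 1/2 * dist u v" for x y u v
  proof (rule dist_bound)
    fix t
    define s where "s = \<tau> t"
    have s: "s \<in> {0..T}" using \<tau> by (simp add: s_def)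
    have int: "((\<lambda>r. c / 2 * exp (c * r) * dist u v) has_integral
        (exp (c * s) * dist u v / 2 - exp (c * 0) * dist u v / 2)) {0..s}"
      using s by (intro fundamental_theorem_of_calculus)
        (auto intro!: derivative_eq_intros simp: has_real_derivative_iff_has_vector_derivative[symmetric])
    have bound: "norm (g u r - g v r) \<le> c / 2 * exp (c * r) * dist u v" for r
    proof -
      have "\<bar>g u r - g v r\<bar> \<le> L * \<bar>exp (c * r) * (apply_bcontfun u r - apply_bcontfun v r)\<bar>"
        using lip[of r "exp (c * r) * apply_bcontfun u r" "exp (c * r) * apply_bcontfun v r"]
        by (simp add: g_def right_diff_distrib)
      also have "\<dots> \<le> c / 2 * \<bar>exp (c * r) * (apply_bcontfun u r - apply_bcontfun v r)\<bar>"
        by (intro mult_right_mono Lc) simp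
      also have "\<dots> = c / 2 * exp (c * r) * dist (apply_bcontfun u r) (apply_bcontfun v r)"
        by (simp add: abs_mult dist_real_def)
      also have "\<dots> \<le> c / 2 * exp (c * r) * dist u v"
        using c by (intro mult_left_mono dist_bounded) auto
      finally show ?thesis by simp
    qed
    have "\<bar>integral {0..s} (g u) - integral {0..s} (g v)\<bar> = norm (integral {0..s} (\<lambda>r. g u r - g v r))"
      by (simp add: integral_diff[OF g_int[OF s] g_int[OF s]])
    also have "\<dots> \<le> integral {0..s} (\<lambda>r. c / 2 * exp (c * r) * dist u v)"
      using int by (intro integral_norm_bound_integral bound integrable_diff g_int s)
        (auto simp: has_integral_iff)
    also have "\<dots> \<le> exp (c * s) * (1/2 * dist u v)"
      using int by (simp add: has_integral_iff)
    finally have I: "\<bar>integral {0..s} (g u) - integral {0..s} (g v)\<bar> \<le> exp (c * s) * (1/2 * dist u v)" .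
    have "h x u s - h y v s
        = exp (- (c * s)) * ((x - y) + (integral {0..s} (g u) - integral {0..s} (g v)))"
      by (simp add: h_def algebra_simps)
    then have "\<bar>h x u s - h y v s\<bar>
        = exp (- (c * s)) * \<bar>(x - y) + (integral {0..s} (g u) - integral {0..s} (g v))\<bar>"
      by (simp add: abs_mult)
    also have "\<dots> \<le> exp (- (c * s)) * (\<bar>x - y\<bar> + exp (c * s) * (1/2 * dist u v))"
      using I abs_triangle_ineq[of "x - y" "integral {0..s} (g u) - integral {0..s} (g v)"]
      by (intro mult_left_mono) auto
    also have "\<dots> = exp (- (c * s)) * \<bar>x - y\<bar> + 1/2 * dist u v"
      by (simp add: distrib_left exp_minus field_simps)
    also have "\<dots> \<le> \<bar>x - y\<bar> + 1/2 * dist u v"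
      using c s by (simp add: mult_left_le_one_le)
    finally show "dist (apply_bcontfun (\<Phi> x u) t) (apply_bcontfun (\<Phi> y v) t) \<le> \<bar>x - y\<bar> + 1/2 * dist u v"
      by (simp add: \<Phi> s_def dist_real_def)
  qed
  have "\<exists>!u. \<Phi> x u = u" for x
    by (rule banach_fix_type[of "1/2"]) (use contr[of x _ x] in auto)
  then obtain U where U: "\<And>x. \<Phi> x (U x) = U x" by metis
  define \<phi> where "\<phi> x t = exp (c * t) * apply_bcontfun (U x) t" for x t
  have eq: "\<phi> x t = x + integral {0..t} (\<lambda>s. G s (\<phi> x s))" if "t \<in> {0..T}" for x t
  proof -
    have "\<phi> x t = exp (c * t) * h x (U x) t"
      using \<Phi>[of x "U x" t] by (simp add: \<phi>_def U \<tau>_id[OF that])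
    then show ?thesis
      by (simp add: h_def g_def[abs_def] \<phi>_def exp_minus)
  qed
  have deriv: "(\<phi> x has_real_derivative G t (\<phi> x t)) (at t within {0..T})" if t: "t \<in> {0..T}" for x t
  proof -
    have "continuous_on {0..T} (\<lambda>s. G s (\<phi> x s))"
      unfolding \<phi>_def by (intro cont continuous_intros continuous_on_apply_bcontfun)
    then have "((\<lambda>t. x + integral {0..t} (\<lambda>s. G s (\<phi> x s))) has_real_derivative G t (\<phi> x t))
        (at t within {0..T})"
      using t by (auto intro!: derivative_eq_intros integral_has_real_derivative)
    then show ?thesis
      by (rule has_field_derivative_transform_within[of _ _ _ _ 1]) (use t eq in auto)
  qed
  have "dist (U x) (U y) \<le> 2 * dist x y" for x y
    using contr[of x "U x" y "U y"] by (simp add: U dist_real_def)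
  then have "dist (\<phi> x T) (\<phi> y T) \<le> exp (c * T) * 2 * dist x y" for x y
    using order.trans[OF dist_bounded[of "U x" T "U y"]]
    by (simp add: \<phi>_def dist_real_def abs_mult flip: right_diff_distrib)
  then have "(exp (c * T) * 2)-lipschitz_on UNIV (\<lambda>x. \<phi> x T)"
    by (intro lipschitz_onI) auto
  then have "continuous_on UNIV (\<lambda>x. \<phi> x T)"
    by (rule lipschitz_on_continuous_on)
  moreover have "\<phi> x 0 = x" for x
    using eq[of 0 x] T by simp
  ultimately show ?thesis
    using that deriv by blast
qed

section \<open>Periodic solutions of scalar equations\<close>

text \<open>
  The fixed point of the period map comes from the intermediate value theorem. The two hypotheses
  on end values quantify over all solutions, so that they can be checked without knowing how the
  flow was constructed.
\<close>

lemma periodic_bvp_solution_between: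
  fixes G :: "real \<Rightarrow> real \<Rightarrow> real"
  assumes T: "0 \<le> T"
    and cont: "\<And>z. continuous_on {0..T} z \<Longrightarrow> continuous_on {0..T} (\<lambda>t. G t (z t))"
    and lip: "\<And>t x y. \<bar>G t x - G t y\<bar> \<le> L * \<bar>x - y\<bar>"
    and le: "p \<le> q"
    and low: "\<And>z. \<lbrakk>\<And>t. t \<in> {0..T} \<Longrightarrow> (z has_real_derivative G t (z t)) (at t within {0..T}); z 0 = p\<rbrakk>
      \<Longrightarrow> p \<le> z T"
    and up: "\<And>z. \<lbrakk>\<And>t. t \<in> {0..T} \<Longrightarrow> (z has_real_derivative G t (z t)) (at t within {0..T}); z 0 = q\<rbrakk>
      \<Longrightarrow> z T \<le> q"
  shows "\<exists>z. periodic_bvp_solution G T z"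
proof -
  obtain \<phi> where \<phi>: "\<And>x. \<phi> x 0 = x"
      "\<And>x t. t \<in> {0..T} \<Longrightarrow> (\<phi> x has_real_derivative G t (\<phi> x t)) (at t within {0..T})"
      and cont_T: "continuous_on UNIV (\<lambda>x. \<phi> x T)"
    using lipschitz_flow[OF T cont lip] by metis
  have "continuous_on {p..q} (\<lambda>x. x - \<phi> x T)"
    by (intro continuous_intros continuous_on_subset[OF cont_T]) auto
  then have "\<exists>x\<ge>p. x \<le> q \<and> x - \<phi> x T = 0"
    using le low[of "\<phi> p"] up[of "\<phi> q"] \<phi> by (intro IVT') auto
  then obtain x where "x = \<phi> x T" by auto
  then have "periodic_bvp_solution G T (\<phi> x)"
    using \<phi> by (simp add: periodic_bvp_solution_def)
  then show ?thesis by blast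
qed

text \<open>
  The extension repeats \<open>z\<close> on every interval \<open>[n T, (n + 1) T]\<close>. At the points \<open>n T\<close> the two
  one-sided derivatives agree, because \<open>z 0 = z T\<close> and the equation is periodic.
\<close>

lemma periodic_extension:
  fixes G :: "real \<Rightarrow> real \<Rightarrow> real"
  assumes T: "0 < T"
    and per: "\<And>t x. G (t + T) x = G t x"
    and z: "periodic_bvp_solution G T z"
  obtains w where "periodic_solution G T w" and "\<And>t. t \<in> {0..T} \<Longrightarrow> w t = z t"
proof -
  define w where "w t = z (t - of_int \<lfloor>t / T\<rfloor> * T)" for t
  have zT: "z T = z 0" and
    dz: "\<And>t. t \<in> {0..T} \<Longrightarrow> (z has_real_derivative G t (z t)) (at t within {0..T})"
    using z by (auto simp: periodic_bvp_solution_def)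
  have per_nat: "G (t + of_nat n * T) x = G t x" for t n x
  proof (induction n)
    case (Suc n)
    then show ?case using per[of "t + of_nat n * T" x] by (simp add: algebra_simps)
  qed simp
  have per_int: "G (t - of_int n * T) x = G t x" for t n x
  proof (cases "n \<ge> 0")
    case True
    then show ?thesis
      using per_nat[of "t - of_int n * T" "nat n" x] by simp
  next
    case False
    then show ?thesis
      using per_nat[of t "nat (- n)" x] by simp
  qed
  \<comment> \<open>Both end points are included: at the right one the floor is \<open>n + 1\<close>, and \<open>z 0 = z T\<close> is needed.\<close>
  have w_eq: "w t = z (t - of_int n * T)" if "t \<in> {of_int n * T..of_int n * T + T}" for n t
  proof (cases "t = of_int n * T + T")
    case True
    then have "t / T = of_int (n + 1)" using T by (simp add: field_simps)
    then have "\<lfloor>t / T\<rfloor> = n + 1" by simp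
    then show ?thesis using True zT by (simp add: w_def algebra_simps)
  next
    case False
    then have "of_int n \<le> t / T" "t / T < of_int n + 1"
      using that T by (auto simp: field_simps)
    then have "\<lfloor>t / T\<rfloor> = n" by linarith
    then show ?thesis by (simp add: w_def)
  qed
  have dw: "(w has_real_derivative G t (w t)) (at t within {of_int n * T..of_int n * T + T})"
    if t: "t \<in> {of_int n * T..of_int n * T + T}" for n t
  proof -
    let ?I = "{of_int n * T..of_int n * T + T}"
    have img: "(\<lambda>s. s - of_int n * T) ` ?I = {0..T}"
      by simp
    have "((z \<circ> (\<lambda>s. s - of_int n * T)) has_real_derivative
        G (t - of_int n * T) (z (t - of_int n * T)) * 1) (at t within ?I)"
      using dz[of "t - of_int n * T"] t
      by (intro DERIV_image_chain) (auto simp: img intro!: derivative_eq_intros)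
    then have "((\<lambda>s. z (s - of_int n * T)) has_real_derivative G t (w t)) (at t within ?I)"
      by (simp add: per_int w_eq[OF t] o_def)
    then show ?thesis
      by (rule has_field_derivative_transform_within[of _ _ _ _ 1]) (use t w_eq in auto)
  qed
  have "(w has_real_derivative G t (w t)) (at t)" for t
  proof -
    define n where "n = \<lfloor>t / T\<rfloor>"
    have "of_int n \<le> t / T" "t / T < of_int n + 1" by (auto simp: n_def)
    then have n: "of_int n * T \<le> t" "t < of_int n * T + T"
      using T by (auto simp: field_simps)
    show ?thesis
    proof (cases "t = of_int n * T")
      case False
      then have "at t within {of_int n * T..of_int n * T + T} = at t"
        using n by (intro at_within_Icc_at) auto
      then show ?thesis using dw[of t n] n by simp
    next
      case True
      let ?A = "{of_int (n - 1) * T..of_int (n - 1) * T + T}"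
      let ?B = "{of_int n * T..of_int n * T + T}"
      have "(w has_real_derivative G t (w t)) (at t within ?A)"
        "(w has_real_derivative G t (w t)) (at t within ?B)"
        by (rule dw; use True T in \<open>simp add: algebra_simps\<close>)+
      then have "(w has_real_derivative G t (w t)) (at t within ?A \<union> ?B)"
        by (simp add: has_field_derivative_iff Lim_Un)
      moreover have "?A \<union> ?B = {of_int (n - 1) * T..of_int n * T + T}"
        using T by (auto simp: algebra_simps)
      moreover have "at t within {of_int (n - 1) * T..of_int n * T + T} = at t"
        using True T by (intro at_within_Icc_at) (auto simp: algebra_simps)
      ultimately show ?thesis by simp
    qed
  qed
  moreover have "w (t + T) = w t" for t
    using T by (simp add: w_def add_divide_distrib algebra_simps)
  ultimately have "periodic_solution G T w" by (simp add: periodic_solution_def)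
  moreover have "w t = z t" if "t \<in> {0..T}" for t
    using w_eq[of t 0] that by simp
  ultimately show ?thesis using that by blast
qed

section \<open>The force of a modulated standing wave\<close>

text \<open>
  The mean value theorem: the \<open>z\<close>-derivative of the force is a combination of \<open>f\<close>, \<open>f'\<close> and
  \<open>f''\<close> with bounded coefficients.
\<close>

lemma Fz_lipschitz:
  assumes f: "\<And>z. (f has_real_derivative f' z) (at z)" and f': "\<And>z. (f' has_real_derivative f'' z) (at z)"
    and "\<And>z. \<bar>f z\<bar> \<le> B0" and "\<And>z. \<bar>f' z\<bar> \<le> B1" and "\<And>z. \<bar>f'' z\<bar> \<le> B2"
  shows "\<bar>Fz F0 k b f t x - Fz F0 k b f t y\<bar> \<le> \<bar>F0\<bar> * (2 * k\<^sup>2 * B0 + 2 * \<bar>k\<bar> * B1 + B2) * \<bar>x - y\<bar>"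
proof -
  let ?S = "\<lambda>z. sin (2 * k * z - b * t)" and ?C = "\<lambda>z. cos (2 * k * z - b * t)"
    and ?Q = "\<lambda>z. (cos (k * z - b * t / 2))\<^sup>2"
  let ?D = "\<lambda>z. F0 * (- 2 * k\<^sup>2 * f z * ?C z - 2 * k * f' z * ?S z + ?Q z * f'' z)"
  have Fz: "Fz F0 k b f t z = - k * F0 * f z * ?S z + F0 * ?Q z * f' z" for z
    unfolding Fz_def by (intro DERIV_imp_deriv V_has_derivative f)
  have S: "?S z = 2 * sin (k * z - b * t / 2) * cos (k * z - b * t / 2)" for z
    using sin_double[of "k * z - b * t / 2"] by (simp add: algebra_simps)
  have "(Fz F0 k b f t has_real_derivative ?D z) (at z)" for z
    unfolding Fz[abs_def] using S[of z]
    by (auto intro!: derivative_eq_intros f f' simp: algebra_simps power2_eq_square)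
  moreover have "norm (?D z) \<le> \<bar>F0\<bar> * (2 * k\<^sup>2 * B0 + 2 * \<bar>k\<bar> * B1 + B2)" for z
  proof -
    have "\<bar>2 * k\<^sup>2 * f z * ?C z\<bar> \<le> 2 * k\<^sup>2 * B0 * 1"
      unfolding abs_mult using assms(3)[of z] by (intro mult_mono) auto
    moreover have "\<bar>2 * k * f' z * ?S z\<bar> \<le> 2 * \<bar>k\<bar> * B1 * 1"
      unfolding abs_mult using assms(4)[of z] by (intro mult_mono) auto
    moreover have "\<bar>?Q z * f'' z\<bar> \<le> 1 * B2"
      unfolding abs_mult using assms(5)[of z]
      by (intro mult_mono) (auto simp: abs_square_le_1)
    ultimately have "\<bar>- 2 * k\<^sup>2 * f z * ?C z - 2 * k * f' z * ?S z + ?Q z * f'' z\<bar>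
        \<le> 2 * k\<^sup>2 * B0 + 2 * \<bar>k\<bar> * B1 + B2"
      by linarith
    then show ?thesis
      unfolding real_norm_def abs_mult by (intro mult_left_mono) auto
  qed
  ultimately show ?thesis
    using field_differentiable_bound[of UNIV "Fz F0 k b f t" ?D
        "\<bar>F0\<bar> * (2 * k\<^sup>2 * B0 + 2 * \<bar>k\<bar> * B1 + B2)" x y] by simp
qed

text \<open>
  The chain rule gives \<open>d/dt V(t, z(t)) = V_t + F\<^sup>2\<close>, and \<open>(2 k / b) V_t\<close> is the negative of the
  oscillating part of \<open>F\<close>. These two cancel in the derivative of \<open>z + (2 k / b) V\<close>, which leaves
  only terms of definite sign when \<open>f'\<close> has one.
\<close>

lemma energy_balance:
  assumes f: "\<And>z. (f has_real_derivative f' z) (at z)" and "b \<noteq> 0"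
    and z: "(z has_real_derivative Fz F0 k b f t (z t)) (at t within S)"
  shows "((\<lambda>t. z t + 2 * k / b * V F0 k b f t (z t)) has_real_derivative
      F0 * (cos (k * z t - b * t / 2))\<^sup>2 * f' (z t) + 2 * k / b * (Fz F0 k b f t (z t))\<^sup>2) (at t within S)"
proof -
  define \<theta> where "\<theta> = k * z t - b * t / 2"
  define F where "F = Fz F0 k b f t (z t)"
  have "sin (2 * k * z t - b * t) = 2 * sin \<theta> * cos \<theta>"
    using sin_double[of \<theta>] by (simp add: \<theta>_def algebra_simps)
  then have F: "F = F0 * (f' (z t) * (cos \<theta>)\<^sup>2 - 2 * k * f (z t) * sin \<theta> * cos \<theta>)"
    unfolding F_def Fz_def by (subst DERIV_imp_deriv[OF V_has_derivative[OF f]]) (simp add: \<theta>_def algebra_simps)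
  have dF: "(z has_real_derivative F) (at t within S)"
    using z by (simp add: F_def)
  have df: "((\<lambda>t. f (z t)) has_real_derivative f' (z t) * F) (at t within S)"
    by (rule DERIV_chain2[OF f dF])
  have "((\<lambda>t. V F0 k b f t (z t)) has_real_derivative
      F * F + b * F0 * f (z t) * sin \<theta> * cos \<theta>) (at t within S)"
    unfolding V_def
    by (auto intro!: derivative_eq_intros df dF)
      (simp add: F \<theta>_def[symmetric] algebra_simps power2_eq_square)
  from DERIV_add[OF dF DERIV_cmult[OF this, of "2 * k / b"]]
  have "((\<lambda>t. z t + 2 * k / b * V F0 k b f t (z t)) has_real_derivative
      F + 2 * k / b * (F * F + b * F0 * f (z t) * sin \<theta> * cos \<theta>)) (at t within S)" .
  moreover have "F + 2 * k / b * (F * F + b * F0 * f (z t) * sin \<theta> * cos \<theta>)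
      = (F + 2 * k * F0 * f (z t) * sin \<theta> * cos \<theta>) + 2 * k / b * F\<^sup>2"
    using \<open>b \<noteq> 0\<close> by (simp add: field_simps power2_eq_square)
  moreover have "F + 2 * k * F0 * f (z t) * sin \<theta> * cos \<theta> = F0 * (cos \<theta>)\<^sup>2 * f' (z t)"
    by (simp add: F algebra_simps)
  ultimately show ?thesis
    unfolding F_def[symmetric] \<theta>_def[symmetric] by simp
qed

section \<open>The Gaussian profile\<close>

locale gaussian_beam =
  fixes F0 k b a :: real
  assumes pos: "0 < F0" "0 < k" "0 < b" "0 < a"
begin

definition profile :: "real \<Rightarrow> real" where
  "profile z = exp (- (a * z\<^sup>2))"

abbreviation force :: "real \<Rightarrow> real \<Rightarrow> real" where
  "force \<equiv> Fz F0 k b profile"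

text \<open>
  The position corrected by the potential, whose derivative along solutions is given by
  \<open>energy_balance\<close>.
\<close>

definition W :: "real \<Rightarrow> real \<Rightarrow> real" where
  "W t z = z + 2 * k / b * V F0 k b profile t z"

text \<open>
  The position \<open>z\<close> at which the bound \<open>(2 k / b) F\<^sup>2 \<le> (8 k / b) F0\<^sup>2 (k\<^sup>2 + a) f(z) cos\<^sup>2 \<theta>\<close> from
  \<open>force_squared_le\<close> equals the restoring term \<open>2 a z F0 f(z) cos\<^sup>2 \<theta>\<close>.
\<close>

definition radius :: real where
  "radius = 4 * k * F0 * (k\<^sup>2 + a) / (a * b)"

lemma radius_pos: "0 < radius"
  using pos by (simp add: radius_def add_pos_nonneg)

lemma profile_pos: "0 < profile z"
  by (simp add: profile_def)

lemma profile_le_1: "profile z \<le> 1"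
  using pos by (simp add: profile_def)

lemma square_times_profile_le_1: "a * z\<^sup>2 * profile z \<le> 1"
proof -
  have "a * z\<^sup>2 \<le> exp (a * z\<^sup>2)"
    using exp_ge_add_one_self[of "a * z\<^sup>2"] by linarith
  then show ?thesis
    by (simp add: profile_def exp_minus field_simps)
qed

lemma DERIV_profile: "(profile has_real_derivative - 2 * a * z * profile z) (at z)"
  unfolding profile_def by (auto intro!: derivative_eq_intros)

lemma DERIV_profile': "((\<lambda>z. - 2 * a * z * profile z) has_real_derivative
    (4 * a\<^sup>2 * z\<^sup>2 - 2 * a) * profile z) (at z)"
  by (auto intro!: derivative_eq_intros DERIV_profile simp: algebra_simps power2_eq_square)

lemma abs_DERIV_profile_le: "\<bar>- 2 * a * z * profile z\<bar> \<le> 2 * (a + 1)"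
proof -
  have "\<bar>z\<bar> \<le> 1 + z\<^sup>2"
    using zero_le_power2[of "\<bar>z\<bar> - 1"] abs_ge_zero[of z]
    by (simp add: power2_diff)
  then have "a * \<bar>z\<bar> * profile z \<le> a * (1 + z\<^sup>2) * profile z"
    using pos profile_pos[of z] by (simp add: mult_right_mono)
  also have "\<dots> \<le> a + 1"
    using square_times_profile_le_1[of z] profile_le_1[of z] pos
    by (simp add: distrib_left distrib_right add_mono)
  finally show ?thesis
    using pos profile_pos[of z] by (simp add: abs_mult)
qed

lemma abs_DERIV_profile'_le: "\<bar>(4 * a\<^sup>2 * z\<^sup>2 - 2 * a) * profile z\<bar> \<le> 4 * a"
proof -
  have "a * (a * z\<^sup>2 * profile z) \<le> a * 1"
    using pos square_times_profile_le_1 by (intro mult_left_mono) auto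
  moreover have "0 \<le> a * (a * z\<^sup>2 * profile z)" "0 \<le> a * profile z" "a * profile z \<le> a * 1"
    using pos profile_pos[of z] profile_le_1[of z] by (auto intro!: mult_left_mono)
  ultimately show ?thesis
    by (simp add: abs_le_iff algebra_simps power2_eq_square)
qed

lemma force_eq: "force t z = - 2 * F0 * profile z * cos (k * z - b * t / 2)
    * (k * sin (k * z - b * t / 2) + a * z * cos (k * z - b * t / 2))"
proof -
  have "sin (2 * k * z - b * t) = 2 * sin (k * z - b * t / 2) * cos (k * z - b * t / 2)"
    using sin_double[of "k * z - b * t / 2"] by (simp add: algebra_simps)
  then show ?thesis
    unfolding Fz_def by (subst DERIV_imp_deriv[OF V_has_derivative[OF DERIV_profile]])
      (simp add: algebra_simps power2_eq_square)
qed

lemma force_lipschitz: "\<exists>L. \<forall>t x y. \<bar>force t x - force t y\<bar> \<le> L * \<bar>x - y\<bar>"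
  using Fz_lipschitz[OF DERIV_profile DERIV_profile' _ abs_DERIV_profile_le abs_DERIV_profile'_le, of 1]
    profile_pos profile_le_1 by (metis abs_of_pos)

lemma continuous_on_force:
  assumes "continuous_on S z"
  shows "continuous_on S (\<lambda>t. force t (z t))"
  unfolding force_eq profile_def by (intro continuous_intros assms) auto

text \<open>
  By the Cauchy-Schwarz inequality \<open>(k sin \<theta> + a z cos \<theta>)\<^sup>2 \<le> k\<^sup>2 + a\<^sup>2 z\<^sup>2\<close>, and one of the two
  factors \<open>f(z)\<close> in \<open>F\<^sup>2\<close> absorbs this growth. The other factor and \<open>cos\<^sup>2 \<theta>\<close> have to remain
  in the bound: they are compared with the restoring term, which carries the same two factors.
\<close>

lemma force_squared_le:
  "(force t z)\<^sup>2 \<le> 4 * F0\<^sup>2 * (k\<^sup>2 + a) * profile z * (cos (k * z - b * t / 2))\<^sup>2"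
proof -
  define \<theta> where "\<theta> = k * z - b * t / 2"
  \<comment> \<open>Lagrange identity, the square that is left over in the Cauchy-Schwarz inequality.\<close>
  have "(k * sin \<theta> + a * z * cos \<theta>)\<^sup>2 + (k * cos \<theta> - a * z * sin \<theta>)\<^sup>2
      = (k\<^sup>2 + a\<^sup>2 * z\<^sup>2) * ((sin \<theta>)\<^sup>2 + (cos \<theta>)\<^sup>2)"
    by algebra
  then have "(k * sin \<theta> + a * z * cos \<theta>)\<^sup>2 \<le> k\<^sup>2 + a\<^sup>2 * z\<^sup>2"
    using zero_le_power2[of "k * cos \<theta> - a * z * sin \<theta>"]
    unfolding sin_cos_squared_add mult_1_right by linarith
  then have "profile z * (k * sin \<theta> + a * z * cos \<theta>)\<^sup>2 \<le> profile z * (k\<^sup>2 + a\<^sup>2 * z\<^sup>2)"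
    using profile_pos[of z] by (intro mult_left_mono) auto
  also have "\<dots> = k\<^sup>2 * profile z + a * (a * z\<^sup>2 * profile z)"
    by (simp add: algebra_simps power2_eq_square)
  also have "\<dots> \<le> k\<^sup>2 * 1 + a * 1"
    using pos by (intro add_mono mult_left_mono square_times_profile_le_1 profile_le_1) auto
  finally have "4 * F0\<^sup>2 * profile z * (cos \<theta>)\<^sup>2 * (profile z * (k * sin \<theta> + a * z * cos \<theta>)\<^sup>2)
      \<le> 4 * F0\<^sup>2 * profile z * (cos \<theta>)\<^sup>2 * (k\<^sup>2 + a)"
    using profile_pos[of z] by (intro mult_left_mono) auto
  then show ?thesis
    unfolding force_eq \<theta>_def[symmetric]
    by (simp add: power_mult_distrib power2_eq_square[of "profile z"] mult_ac)
qed

lemma abs_force_le: "\<bar>force t z\<bar> \<le> 2 * F0 * sqrt (k\<^sup>2 + a)"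
proof (rule abs_le_square_iff[THEN iffD2, THEN order.trans])
  let ?C = "4 * F0\<^sup>2 * (k\<^sup>2 + a)"
  have "(force t z)\<^sup>2 \<le> ?C * profile z * (cos (k * z - b * t / 2))\<^sup>2"
    by (rule force_squared_le)
  also have "\<dots> \<le> ?C * 1 * 1"
    using pos profile_pos[of z] by (intro mult_mono profile_le_1) (auto simp: abs_square_le_1)
  finally show "(force t z)\<^sup>2 \<le> (2 * F0 * sqrt (k\<^sup>2 + a))\<^sup>2"
    using pos by (simp add: power_mult_distrib)
qed (use pos in simp)

text \<open>
  The bound \<open>b / (2 k)\<close> is the one that makes \<open>W\<close> increasing in \<open>z\<close>. It holds far out since
  \<open>F\<^sup>2\<close> decays at least like \<open>1 / z\<^sup>2\<close>; the value \<open>radius\<close> is large enough for it because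
  \<open>a \<le> k\<^sup>2 + a\<close>.
\<close>

lemma abs_force_less:
  assumes "radius < \<bar>z\<bar>"
  shows "\<bar>force t z\<bar> < b / (2 * k)"
proof -
  let ?C = "4 * F0\<^sup>2 * (k\<^sup>2 + a)"
  have C: "0 \<le> ?C" using pos by simp
  have "(force t z)\<^sup>2 \<le> ?C * profile z * (cos (k * z - b * t / 2))\<^sup>2"
    by (rule force_squared_le)
  also have "\<dots> \<le> ?C * profile z * 1"
    using C profile_pos[of z] by (intro mult_left_mono) (auto simp: abs_square_le_1)
  finally have "(a * z\<^sup>2) * (force t z)\<^sup>2 \<le> (a * z\<^sup>2) * (?C * profile z)"
    using pos by (intro mult_left_mono) auto
  also have "\<dots> = ?C * (a * z\<^sup>2 * profile z)" by simp
  also have "\<dots> \<le> ?C * 1"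
    by (intro mult_left_mono C square_times_profile_le_1)
  finally have 1: "(a * z\<^sup>2) * (force t z)\<^sup>2 \<le> ?C" by simp
  have "?C * a \<le> ?C * (k\<^sup>2 + a)"
    using C by (intro mult_left_mono) auto
  also have "\<dots> = (a * radius)\<^sup>2 * (b / (2 * k))\<^sup>2"
    using pos by (simp add: radius_def field_simps power2_eq_square)
  also have "\<dots> < (a * \<bar>z\<bar>)\<^sup>2 * (b / (2 * k))\<^sup>2"
    using pos radius_pos assms by (intro mult_strict_right_mono power_strict_mono) auto
  finally have "?C * a < (a * z\<^sup>2) * (b / (2 * k))\<^sup>2 * a"
    by (simp add: power_mult_distrib power2_eq_square mult_ac)
  moreover have "(a * z\<^sup>2) * (force t z)\<^sup>2 * a \<le> ?C * a"
    using 1 pos by (intro mult_right_mono) auto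
  ultimately have "(a * z\<^sup>2) * (force t z)\<^sup>2 * a < (a * z\<^sup>2) * (b / (2 * k))\<^sup>2 * a"
    by linarith
  then have "(a * z\<^sup>2) * (force t z)\<^sup>2 < (a * z\<^sup>2) * (b / (2 * k))\<^sup>2"
    using pos by (simp only: mult_less_cancel_right_pos)
  then have "\<bar>force t z\<bar>\<^sup>2 < (b / (2 * k))\<^sup>2"
    using pos assms radius_pos by (simp add: mult_less_cancel_left_pos)
  then show ?thesis
    by (rule power2_less_imp_less) (use pos in simp)
qed

lemma W_less:
  assumes "x < y" and far: "\<And>z. z \<in> {x..y} \<Longrightarrow> radius < \<bar>z\<bar>"
  shows "W t x < W t y"
proof (rule DERIV_pos_imp_increasing[OF \<open>x < y\<close>])
  fix z assume z: "x \<le> z" "z \<le> y"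
  have "((\<lambda>z. V F0 k b profile t z) has_real_derivative force t z) (at z)"
    unfolding Fz_def using V_has_derivative[OF DERIV_profile, of F0 k b t z]
    by (simp add: DERIV_imp_deriv)
  then have "(W t has_real_derivative 1 + 2 * k / b * force t z) (at z)"
    unfolding W_def[abs_def] using pos by (auto intro!: derivative_eq_intros)
  moreover have "- (b / (2 * k)) < force t z"
    using abs_force_less[of z t] far z by auto
  then have "0 < 1 + 2 * k / b * force t z"
    using pos by (simp add: field_simps)
  ultimately show "\<exists>D. (W t has_real_derivative D) (at z) \<and> 0 < D" by blast
qed

text \<open>
  In \<open>energy_balance\<close> the nonnegative term \<open>(2 k / b) F\<^sup>2\<close> helps on the left half line, where the
  restoring term is also nonnegative. On the right it works against the restoring term, and
  \<open>radius\<close> is the distance from which it loses.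
\<close>

lemma DERIV_W_along_solution:
  assumes "(z has_real_derivative force t (z t)) (at t within S)"
  obtains D where "((\<lambda>t. W t (z t)) has_real_derivative D) (at t within S)"
    and "radius \<le> z t \<Longrightarrow> D \<le> 0" and "z t \<le> 0 \<Longrightarrow> 0 \<le> D"
proof -
  define c where "c = (cos (k * z t - b * t / 2))\<^sup>2"
  define D where "D = F0 * c * (- 2 * a * z t * profile (z t)) + 2 * k / b * (force t (z t))\<^sup>2"
  have c: "0 \<le> F0 * profile (z t) * c"
    using pos profile_pos[of "z t"] by (simp add: c_def)
  have "((\<lambda>t. W t (z t)) has_real_derivative D) (at t within S)"
    unfolding W_def D_def c_def using pos
    by (intro energy_balance DERIV_profile assms) simp
  moreover have "D \<le> 0" if "radius \<le> z t"
  proof -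
    have "2 * k / b * (force t (z t))\<^sup>2 \<le> 2 * k / b * (4 * F0\<^sup>2 * (k\<^sup>2 + a) * profile (z t) * c)"
      unfolding c_def using pos by (intro mult_left_mono force_squared_le) simp
    also have "\<dots> = 2 * a * radius * (F0 * profile (z t) * c)"
      using pos by (simp add: radius_def field_simps power2_eq_square)
    also have "\<dots> \<le> 2 * a * z t * (F0 * profile (z t) * c)"
      using pos that by (intro mult_right_mono[OF _ c]) simp
    finally show ?thesis by (simp add: D_def mult_ac)
  qed
  moreover have "0 \<le> D" if "z t \<le> 0"
  proof -
    have "0 \<le> - z t * (2 * a) * (F0 * profile (z t) * c)"
      using pos that by (intro mult_nonneg_nonneg c) auto
    moreover have "0 \<le> 2 * k / b * (force t (z t))\<^sup>2"
      using pos by simp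
    ultimately show ?thesis by (simp add: D_def mult_ac)
  qed
  ultimately show ?thesis using that by blast
qed

lemma solution_near_start:
  assumes z: "\<And>t. t \<in> {0..T} \<Longrightarrow> (z has_real_derivative force t (z t)) (at t within {0..T})"
    and t: "t \<in> {0..T}"
  shows "\<bar>z t - z 0\<bar> \<le> 2 * F0 * sqrt (k\<^sup>2 + a) * T"
proof -
  have "norm (z t - z 0) \<le> 2 * F0 * sqrt (k\<^sup>2 + a) * norm (t - 0)"
    by (rule field_differentiable_bound[OF _ z]) (use abs_force_le t in auto)
  also have "\<dots> \<le> 2 * F0 * sqrt (k\<^sup>2 + a) * T"
    using pos t by (intro mult_left_mono) auto
  finally show ?thesis by simp
qed

lemma period_shift: "k * x - b * (t + 4 * pi / b) / 2 = (k * x - b * t / 2) - 2 * pi"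
  using pos by (simp add: field_simps)

lemma V_periodic: "V F0 k b profile (t + 4 * pi / b) = V F0 k b profile t"
  unfolding V_def[abs_def] period_shift by (simp add: cos_diff)

lemma force_periodic: "force (t + 4 * pi / b) x = force t x"
  unfolding Fz_def by (simp only: V_periodic)

text \<open>
  Starting at \<open>\<plusminus> q\<close>, a solution moves by at most \<open>2 F0 sqrt (k\<^sup>2 + a) T\<close> in one period and so
  stays where \<open>W\<close> is monotone in time. Comparing \<open>W\<close> at the two ends of the period and using that
  \<open>W\<close> is increasing in \<open>z\<close> there shows that the solution does not end beyond \<open>\<plusminus> q\<close>.
\<close>

theorem exists_periodic_bvp_solution: "\<exists>z. periodic_bvp_solution force (4 * pi / b) z"
proof -
  define T where "T = 4 * pi / b"
  have T: "0 < T" using pos by (simp add: T_def)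
  obtain L where L: "\<And>t x y. \<bar>force t x - force t y\<bar> \<le> L * \<bar>x - y\<bar>"
    using force_lipschitz by blast
  \<comment> \<open>The summand 1 keeps \<open>q\<close> strictly beyond \<open>radius\<close>, as the strict monotonicity of \<open>W\<close> requires.\<close>
  define q where "q = radius + 1 + 2 * F0 * sqrt (k\<^sup>2 + a) * T"
  have q: "radius < q" using pos T by (simp add: q_def add_pos_nonneg)
  have W_T: "W T x = W 0 x" for x
    using V_periodic[of 0] by (simp add: W_def T_def)
  have cont_W: "continuous_on {0..T} (\<lambda>t. W t (z t))"
    if "\<And>t. t \<in> {0..T} \<Longrightarrow> (z has_real_derivative force t (z t)) (at t within {0..T})" for z
    using DERIV_continuous_on[OF that] pos unfolding W_def V_def profile_def
    by (intro continuous_intros) auto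
  have "\<exists>z. periodic_bvp_solution force T z"
  proof (rule periodic_bvp_solution_between[of T force L "- q" q])
    fix z assume z: "\<And>t. t \<in> {0..T} \<Longrightarrow> (z has_real_derivative force t (z t)) (at t within {0..T})"
      and z0: "z 0 = q"
    have far: "radius \<le> z t" if "t \<in> {0..T}" for t
      using solution_near_start[of T z t] z that z0 unfolding q_def by force
    have "W T (z T) \<le> W 0 (z 0)"
    proof (rule DERIV_nonpos_imp_decreasing_open[of 0 T "\<lambda>t. W t (z t)"])
      fix t assume t: "0 < t" "t < T"
      then have "(z has_real_derivative force t (z t)) (at t)"
        using z[of t] by (simp add: at_within_Icc_at)
      then show "\<exists>D. ((\<lambda>t. W t (z t)) has_real_derivative D) (at t) \<and> D \<le> 0"
        using far[of t] t by (elim DERIV_W_along_solution) auto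
    qed (use T cont_W z in auto)
    moreover have "W 0 q < W 0 (z T)" if "q < z T"
      by (rule W_less[OF that]) (use q radius_pos in auto)
    ultimately show "z T \<le> q"
      unfolding W_T z0 by (meson not_le)
  next
    fix z assume z: "\<And>t. t \<in> {0..T} \<Longrightarrow> (z has_real_derivative force t (z t)) (at t within {0..T})"
      and z0: "z 0 = - q"
    have far: "z t \<le> 0" if "t \<in> {0..T}" for t
      using solution_near_start[of T z t] z that z0 radius_pos unfolding q_def by force
    have "W 0 (z 0) \<le> W T (z T)"
    proof (rule DERIV_nonneg_imp_increasing_open[of 0 T "\<lambda>t. W t (z t)"])
      fix t assume t: "0 < t" "t < T"
      then have "(z has_real_derivative force t (z t)) (at t)"
        using z[of t] by (simp add: at_within_Icc_at)
      then show "\<exists>D. ((\<lambda>t. W t (z t)) has_real_derivative D) (at t) \<and> 0 \<le> D"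
        using far[of t] t by (elim DERIV_W_along_solution) auto
    qed (use T cont_W z in auto)
    moreover have "W 0 (z T) < W 0 (- q)" if "z T < - q"
      by (rule W_less[OF that]) (use q radius_pos in auto)
    ultimately show "- q \<le> z T"
      unfolding W_T z0 by (meson not_le)
  next
    show "- q \<le> q" using q radius_pos by simp
  qed (use T L continuous_on_force in auto)
  then show ?thesis by (simp add: T_def)
qed

end

theorem theorem10:
  fixes F0 k b z0 T :: real and f :: "real \<Rightarrow> real"
  assumes "F0 > 0" and "k > 0" and "b > 0" and "z0 > 0"
    and "T = 4 * pi / b"
    and "f = (\<lambda>z. exp (- 2 * (z\<^sup>2 / z0\<^sup>2)))"
  shows "\<exists>z. periodic_bvp_solution (Fz F0 k b f) T z \<and>
    (\<exists>w. periodic_solution (Fz F0 k b f) T w \<and> (\<forall>t\<in>{0..T}. w t = z t))"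
proof -
  interpret gaussian_beam F0 k b "2 / z0\<^sup>2"
    using assms by unfold_locales auto
  have f: "f = profile"
    using assms by (simp add: profile_def[abs_def])
  obtain z where z: "periodic_bvp_solution force T z"
    using exists_periodic_bvp_solution assms by blast
  have T: "0 < T" using assms by simp
  have per: "force (t + T) x = force t x" for t x
    unfolding \<open>T = 4 * pi / b\<close> by (rule force_periodic)
  obtain w where "periodic_solution force T w" "\<And>t. t \<in> {0..T} \<Longrightarrow> w t = z t"
    by (rule periodic_extension[OF T per z]) blast
  then show ?thesis using z unfolding f by blast
qed

end
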